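(* Let $(E,\|\cdot\|)$ be a normed vector space over $\mathbb{R}$ with dimension at least $2$. Then, for every choice of $a,b\in[0,\infty[$, we have $$\big\{x+y\,:\, x,y\in E,\ \|x\|=a,\ \|y\|=b\big\} \;=\; \big\{z\in E\,:\, |a-b|\le \|z\|\le a+b\big\}$$ and, more generally, for every integer $n\ge 2$ and every $a=(a_1,\ldots,a_n)\in[0,\infty[^n$, $$\Big\{\sum_{i=1}^n x_i\,:\, x_i\in E \text{ and } \|x_i\|=a_i \text{ for each } i\in\{1,\ldots,n\}\Big\} \;=\; \Big\{z\in E\,:\, \max_{k\in\{1,\ldots,n\}}\Big(a_k-\sum_{i\in\{1,\ldots,n\}\setminus\{k\}}a_i\Big)_+\le \|z\|\le \sum_{i=1}^n a_i\Big\}.$$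
   Context: For $c\in\mathbb{R}$, $c_+:=\max\{c,0\}$. The notation $[0,\infty[$ means the half-open interval $\{t\in\mathbb{R} : t\ge 0\}$. The dimension of $E$ may be infinite. *)

theory Defs
  imports Complex_Main
begin

end

(* Two spheres: moving x continuously on the sphere of radius a from the direction of z to the
   opposite one, norm (z - x) runs from |norm z - a| to norm z + a, so it takes the value b.
   General case by induction: split off one summand x, and prescribe for the rest the norm
   r = min (sum of the other radii) (norm z + norm x). *)
theory Submission
  imports Defs
begin

text \<open>If one vector spanned the space, every independent set would be finite with at most one
  element. Dimension at least two is used below only in this form: every line misses some
  vector.\<close>

lemma span_singleton_neq_UNIV:
  fixes u :: "'a::real_normed_vector"
  assumes "independent B" "infinite B \<or> 2 \<le> card (B :: 'a set)"
  shows "span {u} \<noteq> UNIV"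
proof
  assume "span {u} = UNIV"
  then have "finite B \<and> card B \<le> card {u}"
    by (intro independent_span_bound assms) auto
  with assms(2) show False by simp
qed

lemma obtain_norm_diff_eq:
  fixes z :: "'a::real_normed_vector"
  assumes dim: "\<And>u::'a. span {u} \<noteq> UNIV"
    and a: "0 \<le> a" and lower: "\<bar>a - b\<bar> \<le> norm z" and upper: "norm z \<le> a + b"
  obtains x where "norm x = a" "norm (z - x) = b"
proof -
  obtain w where w: "w \<notin> span {z}"
    using dim[of z] by blast
  have w0: "w \<noteq> 0"
    using w span_zero by metis
  show thesis
  \<comment> \<open>For \<open>z = 0\<close> the lower bound forces \<open>a = b\<close>, so any
    \<open>x\<close> of norm \<open>a\<close> works.\<close>
  proof (cases "z = 0")
    case True
    then show thesis
      using w0 a lower that[of "(a / norm w) *\<^sub>R w"] by simp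
  next
    case False
    \<comment> \<open>A half turn from \<open>z\<close> to \<open>- z\<close> in the plane of
      \<open>z\<close> and \<open>w\<close>. Since \<open>w\<close> is not a multiple of
      \<open>z\<close>, the path avoids 0 and can be rescaled to norm \<open>a\<close>.\<close>
    define p where "p t = cos t *\<^sub>R z + sin t *\<^sub>R w" for t
    have p0: "p t \<noteq> 0" for t
    proof
      assume p: "p t = 0"
      show False
      proof (cases "sin t = 0")
        case True
        then have "cos t \<noteq> 0"
          using sin_cos_squared_add[of t] by auto
        with p True False show False by (simp add: p_def)
      next
        case False
        have "sin t *\<^sub>R w = (- cos t) *\<^sub>R z"
          using p by (simp add: p_def eq_neg_iff_add_eq_0 add.commute)
        then have "w = (- cos t / sin t) *\<^sub>R z"
          using False by (metis vector_fraction_eq_iff)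
        with w show False
          by (metis span_base span_scale singletonI)
      qed
    qed
    define x where "x t = (a / norm (p t)) *\<^sub>R p t" for t
    have norm_x: "norm (x t) = a" for t
      using p0[of t] a by (simp add: x_def)
    have cont: "isCont (\<lambda>t. norm (z - x t)) t" for t
      unfolding x_def using p0[of t] unfolding p_def by (intro continuous_intros) auto
    \<comment> \<open>At both ends of the path \<open>x t\<close> is parallel to \<open>z\<close>,
      so the distance to \<open>z\<close> is explicit.\<close>
    have "z - x 0 = (1 - a / norm z) *\<^sub>R z"
      by (simp add: x_def p_def algebra_simps)
    then have "norm (z - x 0) = \<bar>(1 - a / norm z) * norm z\<bar>"
      by (simp add: abs_mult)
    also have "\<dots> = \<bar>norm z - a\<bar>"
      using False by (simp add: left_diff_distrib)
    finally have start: "norm (z - x 0) \<le> b"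
      using lower upper by linarith
    have "z - x pi = (1 + a / norm z) *\<^sub>R z"
      by (simp add: x_def p_def algebra_simps)
    then have "norm (z - x pi) = \<bar>(1 + a / norm z) * norm z\<bar>"
      by (simp add: abs_mult)
    also have "\<dots> = \<bar>norm z + a\<bar>"
      using False by (simp add: distrib_right)
    finally have finish: "b \<le> norm (z - x pi)"
      using lower by linarith
    obtain t where "norm (z - x t) = b"
      using IVT[of "\<lambda>t. norm (z - x t)" 0 b pi] start finish cont by auto
    with norm_x show thesis using that by blast
  qed
qed

text \<open>The bound \<open>2 * a k - sum a I\<close> is \<open>a k\<close> minus the other radii,
  written without removing \<open>k\<close> so that it behaves well under insertion. Any finite
  \<open>I\<close> is allowed, so the induction can start at the empty set, where the upper bound
  forces \<open>z = 0\<close>.\<close>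

lemma ex_sum_eq_with_norms:
  fixes z :: "'a::real_normed_vector" and a :: "'i \<Rightarrow> real"
  assumes dim: "\<And>u::'a. span {u} \<noteq> UNIV"
    and "finite I" "\<And>i. i \<in> I \<Longrightarrow> 0 \<le> a i"
    and "\<And>k. k \<in> I \<Longrightarrow> 2 * a k - sum a I \<le> norm z" "norm z \<le> sum a I"
  shows "\<exists>x. (\<forall>i\<in>I. norm (x i) = a i) \<and> sum x I = z"
  using assms(2-)
proof (induction I arbitrary: z rule: finite_induct)
  case empty
  then show ?case by simp
next
  case (insert j F)
  \<comment> \<open>The norm of the partial sum over \<open>F\<close> may exceed neither
    \<open>sum a F\<close> nor \<open>norm z + a j\<close>. All other constraints bound it from
    below, so the largest admissible value is the safe choice.\<close>
  define r where "r = min (sum a F) (norm z + a j)"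
  have nonneg: "0 \<le> a j" "\<And>i. i \<in> F \<Longrightarrow> 0 \<le> a i"
    using insert.prems(1) by auto
  have sum_nonneg: "0 \<le> sum a F"
    using nonneg(2) by (rule sum_nonneg)
  have sum_insert: "sum a (insert j F) = a j + sum a F"
    using insert.hyps by simp
  have upper: "norm z \<le> a j + sum a F"
    using insert.prems(3) by (simp add: sum_insert)
  have lower_j: "a j - sum a F \<le> norm z"
    using insert.prems(2)[of j] by (simp add: sum_insert)
  have lower_F: "2 * a k - sum a F \<le> r" if "k \<in> F" for k
  proof -
    \<comment> \<open>The two facts here bound \<open>2 * a k - sum a F\<close> by the two arguments
      of the minimum \<open>r\<close>.\<close>
    have "a k \<le> sum a F"
      using insert.hyps(1) nonneg(2) that by (intro member_le_sum) auto
    moreover have "2 * a k - (a j + sum a F) \<le> norm z"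
      using insert.prems(2)[of k] that by (simp add: sum_insert)
    ultimately show ?thesis by (simp add: r_def)
  qed
  have "0 \<le> r" "\<bar>r - a j\<bar> \<le> norm z" "norm z \<le> r + a j"
    using nonneg(1) sum_nonneg upper lower_j norm_ge_zero[of z]
    unfolding r_def by linarith+
  then obtain y where y: "norm y = r" "norm (z - y) = a j"
    using obtain_norm_diff_eq[OF dim] by metis
  obtain x where x: "\<forall>i\<in>F. norm (x i) = a i" "sum x F = y"
    using insert.IH[of y] nonneg(2) lower_F y(1) by (auto simp: r_def)
  have "sum (x(j := z - y)) F = y"
    using x(2) insert.hyps(2) by (metis (mono_tags, lifting) fun_upd_apply sum.cong)
  then show ?case
    using x(1) y(2) insert.hyps by (intro exI[of _ "x(j := z - y)"]) auto
qed

text \<open>The triangle inequality is used twice: to separate \<open>x k\<close> from the remaining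
  sum, then to bound that sum termwise.\<close>

lemma norm_sum_ge_norm_minus_rest:
  fixes x :: "'i \<Rightarrow> 'a::real_normed_vector"
  assumes "finite I" "k \<in> I"
  shows "norm (x k) - (\<Sum>i\<in>I - {k}. norm (x i)) \<le> norm (sum x I)"
proof -
  have "norm (x k) - norm (sum x (I - {k})) \<le> norm (sum x I)"
    using norm_diff_ineq[of "x k" "sum x (I - {k})"] assms by (simp add: sum.remove)
  then show ?thesis
    using norm_sum[of x "I - {k}"] by linarith
qed

theorem mainTheorem1:
  assumes dim_ge_2: "\<exists>B :: 'a::real_normed_vector set.
             independent B \<and> span B = UNIV \<and> (infinite B \<or> 2 \<le> card B)"
  shows "(\<forall>a b :: real. 0 \<le> a \<longrightarrow> 0 \<le> b \<longrightarrow>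
           {x + y | x y :: 'a. norm x = a \<and> norm y = b}
             = {z :: 'a. \<bar>a - b\<bar> \<le> norm z \<and> norm z \<le> a + b}) \<and>
         (\<forall>(n::nat) (a :: nat \<Rightarrow> real). 2 \<le> n \<longrightarrow> (\<forall>i\<in>{1..n}. 0 \<le> a i) \<longrightarrow>
           {(\<Sum>i\<in>{1..n}. x i) | x :: nat \<Rightarrow> 'a. \<forall>i\<in>{1..n}. norm (x i) = a i}
             = {z :: 'a. (MAX k\<in>{1..n}. max (a k - (\<Sum>i\<in>{1..n} - {k}. a i)) 0) \<le> norm z
                        \<and> norm z \<le> (\<Sum>i\<in>{1..n}. a i)})"
proof (intro conjI allI impI)
  have dim: "span {u} \<noteq> UNIV" for u :: 'a
    using dim_ge_2 span_singleton_neq_UNIV by blast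
  {
    fix a b :: real
    assume a: "0 \<le> a" and b: "0 \<le> b"
    show "{x + y | x y :: 'a. norm x = a \<and> norm y = b}
        = {z. \<bar>a - b\<bar> \<le> norm z \<and> norm z \<le> a + b}" (is "?L = ?R")
    proof
      show "?L \<subseteq> ?R"
        \<comment> \<open>The lower bound is the reverse triangle inequality for \<open>x\<close>
          and \<open>- y\<close>.\<close>
        using norm_triangle_ineq norm_triangle_ineq3[of _ "- _"] by auto
      show "?R \<subseteq> ?L"
      proof
        fix z :: 'a
        assume "z \<in> ?R"
        then obtain x where "norm x = a" "norm (z - x) = b"
          using obtain_norm_diff_eq[OF dim a] by blast
        moreover have "z = x + (z - x)" by simp
        ultimately show "z \<in> ?L" by blast
      qed
    qed
  next
    fix n :: nat and a :: "nat \<Rightarrow> real"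
    assume n: "2 \<le> n" and a: "\<forall>i\<in>{1..n}. 0 \<le> a i"
    have Max_iff: "(MAX k\<in>{1..n}. max (a k - (\<Sum>i\<in>{1..n} - {k}. a i)) 0) \<le> c
        \<longleftrightarrow> (\<forall>k\<in>{1..n}. a k - (\<Sum>i\<in>{1..n} - {k}. a i) \<le> c)" if "0 \<le> c" for c
      using n that by (subst Max_le_iff) auto
    show "{(\<Sum>i\<in>{1..n}. x i) | x :: nat \<Rightarrow> 'a. \<forall>i\<in>{1..n}. norm (x i) = a i}
        = {z. (MAX k\<in>{1..n}. max (a k - (\<Sum>i\<in>{1..n} - {k}. a i)) 0) \<le> norm z
              \<and> norm z \<le> (\<Sum>i\<in>{1..n}. a i)}" (is "?L = ?R")
    proof
      show "?L \<subseteq> ?R"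
      proof
        fix z
        assume "z \<in> ?L"
        then obtain x where z: "z = sum x {1..n}" and x: "\<forall>i\<in>{1..n}. norm (x i) = a i"
          by blast
        have "a k - (\<Sum>i\<in>{1..n} - {k}. a i) \<le> norm z" if "k \<in> {1..n}" for k
          using norm_sum_ge_norm_minus_rest[of "{1..n}" k x] that x z by simp
        moreover have "norm z \<le> (\<Sum>i\<in>{1..n}. a i)"
          using norm_sum[of x "{1..n}"] x z by simp
        ultimately show "z \<in> ?R"
          unfolding mem_Collect_eq Max_iff[OF norm_ge_zero] by blast
      qed
      show "?R \<subseteq> ?L"
      proof
        fix z
        assume "z \<in> ?R"
        then have lower: "\<forall>k\<in>{1..n}. a k - (\<Sum>i\<in>{1..n} - {k}. a i) \<le> norm z"
          and upper: "norm z \<le> sum a {1..n}"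
          unfolding mem_Collect_eq Max_iff[OF norm_ge_zero] by blast+
        have "2 * a k - sum a {1..n} \<le> norm z" if "k \<in> {1..n}" for k
          using bspec[OF lower that] that by (simp add: sum_diff1)
        then obtain x where "\<forall>i\<in>{1..n}. norm (x i) = a i" "sum x {1..n} = z"
          using ex_sum_eq_with_norms[OF dim, of "{1..n}" a z] a upper by auto
        then show "z \<in> ?L" by blast
      qed
    qed
  }
qed

end
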